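(* For each $N\in\mathbb N$ let $w=w_N$ be a strictly positive even weight on $\mathfrak X=\{-N,\dots,N\}$, and let $n=n(N)$ be positive integers with $\lim_{N\to\infty}n/N=\gamma\in(0,1)$. Let the kernels $\mathbb K_{2n}$, $\mathfrak K^{(0)}_n$, $\mathfrak K^{(1)}_n$ (depending on $N$ through $w_N$ and $n$) be as in the context. (1) If there exists a kernel $\mathbb K_{\lim}$ such that for all $A,B\in\mathbb Z$ $$\lim_{N\to\infty}\mathbb K_{2n}(A,B)=\mathbb K_{\lim}(A,B),$$ then for all $A,B\in\mathbb Z$ $$\lim_{N\to\infty}\mathfrak K^{(0)}_n(A,B)=\eta(A)\eta(B)\left[\mathbb K_{\lim}(A,B)+\mathbb K_{\lim}(-A,B)\right],$$ $$\lim_{N\to\infty}\mathfrak K^{(1)}_n(A,B)=\mathbb K_{\lim}(A,B)-\mathbb K_{\lim}(-A,B).$$ (2) If there exist a sequence $\{D_n\}$ with $D_n=o(n)$, $D_n\to\infty$, and a kernel $\mathbb K_{\lim}$ such that for all $A,B\in\mathbb R$ $$\lim_{N\to\infty}D_n\,\mathbb K_{2n}([D_nA],[D_nB])=\mathbb K_{\lim}(A,B),$$ then for all $A,B\in\mathbb R$ $$\lim_{N\to\infty}D_n\,\mathfrak K^{(0)}_n([D_nA],[D_nB])=\eta(A)\eta(B)\left[\mathbb K_{\lim}(A,B)+\mathbb K_{\lim}(-A,B)\right],$$ $$\lim_{N\to\infty}D_n\,\mathfrak K^{(1)}_n([D_nA],[D_nB])=\mathbb K_{\lim}(A,B)-\mathbb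 K_{\lim}(-A,B).$$
   Context: Fix $N$ and a strictly positive even weight $w$ on $\mathfrak X=\{-N,\dots,N\}$. $P_m$ ($0\le m\le 2N$) are the monic orthogonal polynomials with $\sum_{x\in\mathfrak X}P_m(x)P_\ell(x)w(x)=\delta_{m\ell}h_m^2$, $h_m>0$, and $p_m(x)=P_m(x)\sqrt{w(x)}/h_m$. The Christoffel--Darboux kernel is $\mathbb K_{k}(x,y)=\sum_{i=0}^{k-1}p_i(x)p_i(y)$. $\hat P_m$ ($0\le m\le2N-1$) are the monic orthogonal polynomials on $\mathfrak X$ with respect to $x^2w(x)$, with norms $\hat h_m>0$, and $\hat p_m(x)=\hat P_m(x)\,x\sqrt{w(x)}/\hat h_m$. $\eta(x)=1$ for real $x\neq0$ and $\eta(0)=1/\sqrt2$. For $x,y\in\mathfrak X$, $$\mathfrak K^{(0)}_n(x,y)=2\eta(x)\eta(y)\sum_{\ell=0}^{n-1}p_{2\ell}(x)p_{2\ell}(y),\qquad \mathfrak K^{(1)}_n(x,y)=2\sum_{\ell=0}^{n-1}\hat p_{2\ell}(x)\hat p_{2\ell}(y).$$ $[t]$ denotes a symmetric nearest-integer rounding of $t\in\mathbb R$: an integer nearest to $t$, with ties resolved so that $[-t]=-[t]$ for all $t$. *)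

theory Defs
  imports Complex_Main "HOL-Computational_Algebra.Polynomial" "HOL-Library.Landau_Symbols"
begin

definition grid :: "nat \<Rightarrow> int set" where
  "grid N = {- int N..int N}"

definition positive_even_weight :: "nat \<Rightarrow> (int \<Rightarrow> real) \<Rightarrow> bool" where
  "positive_even_weight N w \<longleftrightarrow> (\<forall>x\<in>grid N. w x > 0 \<and> w (- x) = w x)"

text \<open>
  The polynomials \<open>P 0, \<dots>, P (M - 1)\<close> are monic and orthogonal on \<open>X\<close> for the weight \<open>w\<close>, with
  norms \<open>h 0, \<dots>, h (M - 1)\<close>. Values of \<open>P\<close> and \<open>h\<close> at indices \<open>\<ge> M\<close> are unconstrained; the
  constrained ones are uniquely determined by \<open>X\<close> and \<open>w\<close>.
\<close>

definition monic_orthogonal ::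
  "int set \<Rightarrow> (int \<Rightarrow> real) \<Rightarrow> nat \<Rightarrow> (nat \<Rightarrow> real poly) \<Rightarrow> (nat \<Rightarrow> real) \<Rightarrow> bool" where
  "monic_orthogonal X w M P h \<longleftrightarrow>
     (\<forall>m<M. degree (P m) = m \<and> lead_coeff (P m) = 1 \<and> h m > 0) \<and>
     (\<forall>m<M. \<forall>l<M. (\<Sum>x\<in>X. poly (P m) (of_int x) * poly (P l) (of_int x) * w x)
                     = (if m = l then (h m)\<^sup>2 else 0))"

text \<open>
  Such a family exists whenever \<open>w\<close> is nonnegative and has at least \<open>M\<close> points in its support. On
  \<open>grid N\<close> this allows \<open>M = 2 * N + 1\<close> for a positive weight \<open>w x\<close>, but only \<open>M = 2 * N\<close> for the
  weight \<open>x\<^sup>2 * w x\<close>, which vanishes at the origin.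
\<close>

lemma monic_orthogonal_exists:
  assumes fin: "finite X" and nn: "\<And>x. x \<in> X \<Longrightarrow> w x \<ge> 0"
    and "M \<le> card {x\<in>X. w x > 0}"
  shows "\<exists>P h. monic_orthogonal X w M P h"
  using assms(3)
proof (induction M)
  case 0
  show ?case by (auto simp: monic_orthogonal_def)
next
  case (Suc M)
  define ip where "ip p q = (\<Sum>x\<in>X. poly p (of_int x) * poly q (of_int x) * w x)" for p q
  have ip_comm: "ip p q = ip q p" for p q
    by (simp add: ip_def mult.commute)
  have ip_diff: "ip (p - q) r = ip p r - ip q r" for p q r
    by (simp add: ip_def algebra_simps sum_subtractf)
  have ip_sum: "ip (\<Sum>l<k. smult (c l) (f l)) r = (\<Sum>l<k. c l * ip (f l) r)" for k :: nat and c f r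
    by (induction k) (simp_all add: ip_def algebra_simps sum.distrib sum_distrib_left)
  from Suc obtain P h where Ph: "monic_orthogonal X w M P h" by auto
  have deg: "degree (P m) = m" and lc: "lead_coeff (P m) = 1" and hpos: "h m > 0" if "m < M" for m
    using Ph that by (auto simp: monic_orthogonal_def)
  have orth: "ip (P m) (P l) = (if m = l then (h m)\<^sup>2 else 0)" if "m < M" "l < M" for m l
    using Ph that unfolding monic_orthogonal_def ip_def by blast
  define c where "c l = ip (monom 1 M) (P l) / (h l)\<^sup>2" for l
  define S where "S = (\<Sum>l<M. smult (c l) (P l))"
  define Q where "Q = monom 1 M - S"
  have S0: "coeff S k = 0" if "k \<ge> M" for k
    unfolding S_def coeff_sum using that deg by (auto intro!: sum.neutral simp: coeff_eq_0)
  have Q_coeff: "coeff Q k = (if k = M then 1 else 0)" if "k \<ge> M" for k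
    using S0[OF that] by (auto simp: Q_def)
  have degQ: "degree Q = M"
    by (intro antisym degree_le le_degree) (auto simp: Q_coeff)
  have lcQ: "lead_coeff Q = 1"
    by (simp add: degQ Q_coeff)
  have Q_orth: "ip Q (P l) = 0" if "l < M" for l
  proof -
    have "ip S (P l) = (\<Sum>k<M. c k * ip (P k) (P l))"
      by (simp add: S_def ip_sum)
    also have "\<dots> = (\<Sum>k<M. if k = l then c l * (h l)\<^sup>2 else 0)"
      using that by (intro sum.cong) (auto simp: orth)
    also have "\<dots> = ip (monom 1 M) (P l)"
      using that hpos[OF that] by (simp add: c_def)
    finally show ?thesis by (simp add: Q_def ip_diff)
  qed
  have Q_pos: "ip Q Q > 0"
  proof (rule ccontr)
    assume "\<not> ip Q Q > 0"
    moreover have "ip Q Q \<ge> 0"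
      unfolding ip_def using nn by (intro sum_nonneg) auto
    ultimately have "ip Q Q = 0" by simp
    then have "\<forall>x\<in>X. poly Q (of_int x) * poly Q (of_int x) * w x = 0"
      unfolding ip_def using nn fin by (subst (asm) sum_nonneg_eq_0_iff) auto
    then have sub: "real_of_int ` {x\<in>X. w x > 0} \<subseteq> {z. poly Q z = 0}"
      by (auto dest: less_imp_neq)
    have "Q \<noteq> 0" using lcQ by auto
    have "card {x\<in>X. w x > 0} = card (real_of_int ` {x\<in>X. w x > 0})"
      by (simp add: card_image inj_on_def)
    also have "\<dots> \<le> card {z. poly Q z = 0}"
      using sub poly_roots_finite[OF \<open>Q \<noteq> 0\<close>] by (rule card_mono[rotated])
    also have "\<dots> \<le> M"
      using card_poly_roots_bound[OF \<open>Q \<noteq> 0\<close>] degQ by simp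
    finally show False using Suc.prems by simp
  qed
  have "monic_orthogonal X w (Suc M) (P(M := Q)) (h(M := sqrt (ip Q Q)))"
    unfolding monic_orthogonal_def ip_def[symmetric]
  proof (intro conjI allI impI)
    fix m l assume ml: "m < Suc M" "l < Suc M"
    have "ip (P l) Q = 0" if "l < M" for l
      using Q_orth[OF that] by (simp add: ip_comm[of _ Q])
    then show "ip ((P(M := Q)) m) ((P(M := Q)) l)
        = (if m = l then ((h(M := sqrt (ip Q Q))) m)\<^sup>2 else 0)"
      using ml Q_pos by (cases "m = M"; cases "l = M") (simp_all add: orth Q_orth)
  qed (use deg lc hpos degQ lcQ Q_pos in \<open>auto simp: less_Suc_eq\<close>)
  then show ?case by blast
qed

definition orth_fun :: "(int \<Rightarrow> real) \<Rightarrow> (nat \<Rightarrow> real poly) \<Rightarrow> (nat \<Rightarrow> real) \<Rightarrow> nat \<Rightarrow> int \<Rightarrow> real" where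
  "orth_fun w P h m x = poly (P m) (of_int x) * sqrt (w x) / h m"

definition orth_fun_hat :: "(int \<Rightarrow> real) \<Rightarrow> (nat \<Rightarrow> real poly) \<Rightarrow> (nat \<Rightarrow> real) \<Rightarrow> nat \<Rightarrow> int \<Rightarrow> real" where
  "orth_fun_hat w P' h' m x = poly (P' m) (of_int x) * of_int x * sqrt (w x) / h' m"

definition CD_kernel ::
  "(int \<Rightarrow> real) \<Rightarrow> (nat \<Rightarrow> real poly) \<Rightarrow> (nat \<Rightarrow> real) \<Rightarrow> nat \<Rightarrow> int \<Rightarrow> int \<Rightarrow> real" where
  "CD_kernel w P h k x y = (\<Sum>i<k. orth_fun w P h i x * orth_fun w P h i y)"

definition eta :: "real \<Rightarrow> real" where
  "eta x = (if x = 0 then 1 / sqrt 2 else 1)"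

definition kernel0 ::
  "(int \<Rightarrow> real) \<Rightarrow> (nat \<Rightarrow> real poly) \<Rightarrow> (nat \<Rightarrow> real) \<Rightarrow> nat \<Rightarrow> int \<Rightarrow> int \<Rightarrow> real" where
  "kernel0 w P h n x y =
     2 * eta (of_int x) * eta (of_int y) *
       (\<Sum>l<n. orth_fun w P h (2 * l) x * orth_fun w P h (2 * l) y)"

definition kernel1 ::
  "(int \<Rightarrow> real) \<Rightarrow> (nat \<Rightarrow> real poly) \<Rightarrow> (nat \<Rightarrow> real) \<Rightarrow> nat \<Rightarrow> int \<Rightarrow> int \<Rightarrow> real" where
  "kernel1 w P' h' n x y =
     2 * (\<Sum>l<n. orth_fun_hat w P' h' (2 * l) x * orth_fun_hat w P' h' (2 * l) y)"

text \<open>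
  HOL's \<^const>\<open>round\<close> rounds all half-integers up, so it is not odd. Any choice at the
  half-integers is allowed here, subject to oddness.
\<close>

definition symmetric_rounding :: "(real \<Rightarrow> int) \<Rightarrow> bool" where
  "symmetric_rounding r \<longleftrightarrow>
     (\<forall>t. \<forall>k::int. \<bar>t - of_int (r t)\<bar> \<le> \<bar>t - of_int k\<bar>) \<and> (\<forall>t. r (- t) = - r t)"

end

theory Submission
  imports Defs
begin

text \<open>
  The limits follow from two identities that hold for every \<open>N\<close> with \<open>n \<le> N\<close> and all \<open>x, y\<close> on the
  grid:
  \<open>kernel0 x y = eta x * eta y * (K x y + K (- x) y)\<close> and \<open>kernel1 x y = K x y - K (- x) y\<close>,
  where \<open>K\<close> is the Christoffel--Darboux kernel of order \<open>2 * n\<close>.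

  Since the weight is even, uniqueness of monic orthogonal polynomials forces \<open>P m\<close> to have the
  parity of \<open>m\<close> (\<open>monic_orthogonal_parity\<close>). Symmetrizing \<open>K\<close> in \<open>x\<close> therefore doubles
  the terms of even index and removes the others; antisymmetrizing keeps the odd ones. The first
  identity is then immediate. For the second, \<open>x\<close> times the polynomial of even degree \<open>m\<close> for
  the weight \<open>x\<^sup>2 * w\<close> is monic of degree \<open>m + 1\<close>; it is orthogonal for \<open>w\<close> to the even
  polynomials by parity and to the odd ones of lower degree because these are \<open>x\<close> times a polynomial
  of degree below \<open>m\<close>. Hence it is the orthogonal polynomial of degree \<open>m + 1\<close> for \<open>w\<close>
  (\<open>monic_orthogonal_hat\<close>), and the functions in \<open>kernel1\<close> are those of odd index in \<open>K\<close>.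

  In the limit, \<open>n \<le> N\<close> eventually holds because \<open>\<gamma> < 1\<close>, and the points of evaluation eventually
  lie on the grid, in the rescaled case because \<open>D n = o(n)\<close>. Oddness of the rounding turns the
  reflection of the grid point into the reflection of \<open>A\<close>, and as \<open>D n\<close> tends to infinity, the
  rounded point \<open>D n * A\<close> is eventually zero only if \<open>A = 0\<close>, so \<open>eta\<close> is evaluated
  consistently.
\<close>

section \<open>Uniqueness of monic orthogonal polynomials\<close>

definition weighted_inner :: "int set \<Rightarrow> (int \<Rightarrow> real) \<Rightarrow> real poly \<Rightarrow> real poly \<Rightarrow> real" where
  "weighted_inner X w p q = (\<Sum>x\<in>X. poly p (of_int x) * poly q (of_int x) * w x)"

lemma weighted_inner_commute: "weighted_inner X w p q = weighted_inner X w q p"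
  by (simp add: weighted_inner_def mult.commute)

lemma weighted_inner_diff: "weighted_inner X w (p - q) s = weighted_inner X w p s - weighted_inner X w q s"
  by (simp add: weighted_inner_def algebra_simps sum_subtractf)

lemma weighted_inner_smult: "weighted_inner X w (smult c p) s = c * weighted_inner X w p s"
  by (simp add: weighted_inner_def algebra_simps sum_distrib_left)

lemma monic_orthogonalD:
  assumes "monic_orthogonal X w M P h" "m < M"
  shows "degree (P m) = m" "coeff (P m) m = 1" "h m > 0"
  using assms by (auto simp: monic_orthogonal_def)

lemma monic_orthogonal_inner:
  assumes "monic_orthogonal X w M P h" "m < M" "l < M"
  shows "weighted_inner X w (P m) (P l) = (if m = l then (h m)\<^sup>2 else 0)"
  using assms by (auto simp: monic_orthogonal_def weighted_inner_def)

lemma monic_orthogonal_lower_degree: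
  assumes mo: "monic_orthogonal X w M P h" and "d < M"
    and "\<And>i. i \<ge> d \<Longrightarrow> coeff R i = 0"
  shows "weighted_inner X w R (P d) = 0"
proof -
  \<comment> \<open>Subtracting a multiple of \<open>P k\<close> cancels the coefficient of index \<open>k\<close>, the highest one left.\<close>
  have "weighted_inner X w R (P d) = 0"
    if "k \<le> d" "\<And>i. i \<ge> k \<Longrightarrow> coeff R i = 0" for k R
    using that
  proof (induction k arbitrary: R)
    case 0
    then have "R = 0" by (simp add: poly_eq_iff)
    then show ?case by (simp add: weighted_inner_def)
  next
    case (Suc k)
    have kM: "k < M" using Suc.prems(1) \<open>d < M\<close> by simp
    have "coeff (R - smult (coeff R k) (P k)) i = 0" if "i \<ge> k" for i
    proof (cases "i = k")
      case True
      then show ?thesis by (simp add: monic_orthogonalD[OF mo kM])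
    next
      case False
      then show ?thesis
        using that Suc.prems(2)[of i] monic_orthogonalD(1)[OF mo kM] by (simp add: coeff_eq_0)
    qed
    then have "weighted_inner X w (R - smult (coeff R k) (P k)) (P d) = 0"
      by (rule Suc.IH[OF Suc_leD[OF Suc.prems(1)]])
    moreover have "weighted_inner X w (P k) (P d) = 0"
      using Suc.prems(1) monic_orthogonal_inner[OF mo kM \<open>d < M\<close>] by simp
    ultimately show ?case
      by (simp add: weighted_inner_diff weighted_inner_smult)
  qed
  then show ?thesis using assms(3) by blast
qed

text \<open>
  The leading coefficient of a polynomial of degree \<open>d\<close> is read off from its inner product with
  \<open>P d\<close>. So no nonzero polynomial of degree below \<open>M\<close> is orthogonal to all \<open>P d\<close>, which is the
  nondegeneracy that uniqueness needs. The nondegeneracy comes from \<open>h d > 0\<close>, so the weight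
  \<open>x\<^sup>2 * w\<close>, which vanishes at the origin, is covered.
\<close>
lemma monic_orthogonal_unique:
  assumes mo: "monic_orthogonal X w M P h" and mM: "m < M"
    and deg: "degree Q = m" and monic: "coeff Q m = 1"
    and orth: "\<And>l. l < m \<Longrightarrow> weighted_inner X w Q (P l) = 0"
  shows "Q = P m"
proof (rule ccontr)
  assume "Q \<noteq> P m"
  define R where "R = Q - P m"
  define d where "d = degree R"
  have "R \<noteq> 0" using \<open>Q \<noteq> P m\<close> by (simp add: R_def)
  have lead: "coeff R d \<noteq> 0" using \<open>R \<noteq> 0\<close> by (simp add: d_def)
  have "coeff R i = 0" if "i \<ge> m" for i
    using that deg monic monic_orthogonalD[OF mo mM]
    by (cases "i = m") (auto simp: R_def coeff_eq_0)
  then have dm: "d < m" using lead by (meson not_le)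
  then have dM: "d < M" using mM by simp
  have "coeff (R - smult (coeff R d) (P d)) i = 0" if "i \<ge> d" for i
    using that monic_orthogonalD[OF mo dM] by (cases "i = d") (auto simp: d_def coeff_eq_0)
  then have "weighted_inner X w (R - smult (coeff R d) (P d)) (P d) = 0"
    by (rule monic_orthogonal_lower_degree[OF mo dM])
  then have "weighted_inner X w R (P d) = coeff R d * (h d)\<^sup>2"
    using monic_orthogonal_inner[OF mo dM dM]
    by (simp add: weighted_inner_diff weighted_inner_smult)
  moreover have "weighted_inner X w R (P d) = 0"
    using orth[OF dm] monic_orthogonal_inner[OF mo mM dM] dm
    by (simp add: R_def weighted_inner_diff)
  ultimately show False
    using lead monic_orthogonalD(3)[OF mo dM] by simp
qed

section \<open>Parity for even weights\<close>

lemma sum_symmetric_reflect: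
  fixes f :: "int \<Rightarrow> 'a :: comm_monoid_add"
  assumes "uminus ` X = X"
  shows "(\<Sum>x\<in>X. f (- x)) = sum f X"
  using sum.reindex[of uminus X f] assms by (simp add: o_def)

text \<open>
  Reflecting \<open>P m\<close> and correcting the sign gives a monic polynomial that is again orthogonal to all
  polynomials of lower degree, hence \<open>P m\<close> itself.
\<close>
lemma monic_orthogonal_parity:
  assumes mo: "monic_orthogonal X w M P h" and mM: "m < M"
    and sym: "uminus ` X = X" and even: "\<forall>x\<in>X. w (- x) = w x"
  shows "poly (P m) (- x) = (- 1) ^ m * poly (P m) x"
proof -
  define reflect where "reflect p = pcompose p [:0, - 1:]" for p :: "real poly"
  have poly_reflect: "poly (reflect p) y = poly p (- y)" for p y
    by (simp add: reflect_def poly_pcompose)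
  have deg_reflect: "degree (reflect p) = degree p" for p
    by (simp add: reflect_def degree_pcompose)
  have lead: "coeff (reflect (P m)) m = (- 1) ^ m"
  proof -
    have "lead_coeff (reflect (P m)) = lead_coeff (P m) * (- 1) ^ degree (P m)"
      by (simp add: reflect_def lead_coeff_comp)
    then show ?thesis
      using monic_orthogonalD[OF mo mM] by (simp add: deg_reflect)
  qed
  have inner_reflect: "weighted_inner X w (reflect p) q = weighted_inner X w p (reflect q)" for p q
  proof -
    have "weighted_inner X w (reflect p) q =
        (\<Sum>x\<in>X. poly (reflect p) (of_int (- x)) * poly q (of_int (- x)) * w (- x))"
      unfolding weighted_inner_def by (rule sum_symmetric_reflect[OF sym, symmetric])
    also have "\<dots> = weighted_inner X w p (reflect q)"
      unfolding weighted_inner_def by (intro sum.cong) (auto simp: poly_reflect even)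
    finally show ?thesis .
  qed
  have "smult ((- 1) ^ m) (reflect (P m)) = P m"
  proof (rule monic_orthogonal_unique[OF mo mM])
    show "degree (smult ((- 1) ^ m) (reflect (P m))) = m"
      using monic_orthogonalD[OF mo mM] by (simp add: deg_reflect)
    show "coeff (smult ((- 1) ^ m) (reflect (P m))) m = 1"
      by (simp add: lead flip: power_mult_distrib)
    fix l assume "l < m"
    then have "weighted_inner X w (reflect (P l)) (P m) = 0"
      using mM monic_orthogonalD(1)[OF mo, of l]
      by (intro monic_orthogonal_lower_degree[OF mo mM]) (simp add: coeff_eq_0 deg_reflect)
    then show "weighted_inner X w (smult ((- 1) ^ m) (reflect (P m))) (P l) = 0"
      by (simp add: weighted_inner_smult inner_reflect weighted_inner_commute[of X w "P m"])
  qed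
  then have "(- 1) ^ m * poly (P m) (- (- x)) = poly (P m) (- x)"
    by (metis poly_reflect poly_smult)
  then show ?thesis by simp
qed

lemma weighted_inner_times_x:
  "weighted_inner X w (pCons 0 p) (pCons 0 q) = weighted_inner X (\<lambda>x. (of_int x)\<^sup>2 * w x) p q"
  by (simp add: weighted_inner_def power2_eq_square algebra_simps)

text \<open>
  The degree has to be even: then \<open>x * P' m\<close> is odd, and its orthogonality to the even polynomials,
  including those with nonzero value at the origin, is free.
\<close>
lemma monic_orthogonal_hat:
  assumes mo: "monic_orthogonal X w M P h"
    and mo': "monic_orthogonal X (\<lambda>x. (of_int x)\<^sup>2 * w x) M' P' h'"
    and sym: "uminus ` X = X" and even_w: "\<forall>x\<in>X. w (- x) = w x"
    and "even m" and mM: "Suc m < M" and mM': "m < M'"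
  shows "pCons 0 (P' m) = P (Suc m)" and "h' m = h (Suc m)"
proof -
  have even_w': "\<forall>x\<in>X. (of_int (- x))\<^sup>2 * w (- x) = (of_int x)\<^sup>2 * w x"
    using even_w by simp
  have P'_even: "poly (P' m) (- x) = poly (P' m) x" for x
    using monic_orthogonal_parity[OF mo' mM' sym, OF even_w'] \<open>even m\<close> by simp
  have "P' m \<noteq> 0" using monic_orthogonalD(2)[OF mo' mM'] by auto
  show eq: "pCons 0 (P' m) = P (Suc m)"
  proof (rule monic_orthogonal_unique[OF mo mM])
    show "degree (pCons 0 (P' m)) = Suc m"
      using monic_orthogonalD(1)[OF mo' mM'] \<open>P' m \<noteq> 0\<close> by simp
    show "coeff (pCons 0 (P' m)) (Suc m) = 1"
      using monic_orthogonalD(2)[OF mo' mM'] by simp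
    fix l assume l: "l < Suc m"
    then have lM: "l < M" using mM by simp
    note parity = monic_orthogonal_parity[OF mo lM sym, OF even_w]
    show "weighted_inner X w (pCons 0 (P' m)) (P l) = 0"
    proof (cases "even l")
      case True
      let ?f = "\<lambda>x. poly (pCons 0 (P' m)) (of_int x) * poly (P l) (of_int x) * w x"
      have "sum ?f X = (\<Sum>x\<in>X. ?f (- x))"
        by (rule sum_symmetric_reflect[OF sym, symmetric])
      also have "\<dots> = (\<Sum>x\<in>X. - ?f x)"
        by (intro sum.cong) (use True in \<open>auto simp: P'_even parity even_w\<close>)
      finally show ?thesis by (simp add: weighted_inner_def sum_negf)
    next
      case False
      have "poly (P l) 0 = 0" using parity[of 0] False by simp
      then obtain R where R: "P l = pCons 0 R"
        by (cases "P l") auto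
      have "coeff R i = 0" if "i \<ge> m" for i
      proof -
        have "coeff (P l) (Suc i) = 0"
          using that l monic_orthogonalD(1)[OF mo lM] by (intro coeff_eq_0) simp
        then show ?thesis by (simp add: R)
      qed
      then have "weighted_inner X (\<lambda>x. (of_int x)\<^sup>2 * w x) R (P' m) = 0"
        by (rule monic_orthogonal_lower_degree[OF mo' mM'])
      then show ?thesis
        by (simp add: R weighted_inner_times_x weighted_inner_commute)
    qed
  qed
  have "(h' m)\<^sup>2 = weighted_inner X w (pCons 0 (P' m)) (pCons 0 (P' m))"
    using monic_orthogonal_inner[OF mo' mM' mM'] by (simp add: weighted_inner_times_x)
  also have "\<dots> = (h (Suc m))\<^sup>2"
    using monic_orthogonal_inner[OF mo mM mM] by (simp add: eq)
  finally show "h' m = h (Suc m)"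
    using monic_orthogonalD(3)[OF mo' mM'] monic_orthogonalD(3)[OF mo mM]
    by (simp add: power2_eq_iff)
qed

section \<open>The kernels at finite size\<close>

lemma uminus_grid: "uminus ` grid N = grid N"
  by (simp add: grid_def)

lemma positive_even_weightD: "positive_even_weight N w \<Longrightarrow> \<forall>x\<in>grid N. w (- x) = w x"
  by (simp add: positive_even_weight_def)

lemma orth_fun_reflect:
  assumes "positive_even_weight N w" "monic_orthogonal (grid N) w M P h" "m < M" "x \<in> grid N"
  shows "orth_fun w P h m (- x) = (- 1) ^ m * orth_fun w P h m x"
  using monic_orthogonal_parity[OF assms(2,3) uminus_grid, OF positive_even_weightD[OF assms(1)]]
    positive_even_weightD[OF assms(1)] assms(4)
  by (simp add: orth_fun_def)

lemma orth_fun_hat_even: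
  assumes "positive_even_weight N w" "monic_orthogonal (grid N) w M P h"
    and "monic_orthogonal (grid N) (\<lambda>x. (of_int x)\<^sup>2 * w x) M' P' h'"
    and "even m" "Suc m < M" "m < M'"
  shows "orth_fun_hat w P' h' m x = orth_fun w P h (Suc m) x"
proof -
  note hat = monic_orthogonal_hat[OF assms(2,3) uminus_grid,
      OF positive_even_weightD[OF assms(1)] assms(4-6)]
  have "poly (P (Suc m)) (of_int x) = of_int x * poly (P' m) (of_int x)"
    by (simp flip: hat(1))
  then show ?thesis
    by (simp add: orth_fun_hat_def orth_fun_def hat(2) mult_ac)
qed

lemma sum_even_odd_split:
  fixes f :: "nat \<Rightarrow> real"
  shows "(\<Sum>i<2 * n. f i) = (\<Sum>l<n. f (2 * l)) + (\<Sum>l<n. f (Suc (2 * l)))"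
  by (induction n) simp_all

lemma CD_kernel_reflect:
  assumes "positive_even_weight N w" "monic_orthogonal (grid N) w M P h"
    and "2 * n \<le> M" and x: "x \<in> grid N"
  defines "p \<equiv> orth_fun w P h"
  shows "CD_kernel w P h (2 * n) (- x) y
       = (\<Sum>l<n. p (2 * l) x * p (2 * l) y) - (\<Sum>l<n. p (Suc (2 * l)) x * p (Suc (2 * l)) y)"
proof -
  have "p i (- x) = (- 1) ^ i * p i x" if "i < 2 * n" for i
    unfolding p_def using that assms(3) by (intro orth_fun_reflect[OF assms(1,2) _ x]) simp
  then have "CD_kernel w P h (2 * n) (- x) y = (\<Sum>i<2 * n. (- 1) ^ i * p i x * p i y)"
    by (simp add: CD_kernel_def flip: p_def)
  then show ?thesis by (simp add: sum_even_odd_split sum_negf)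
qed

lemma kernel0_eq_CD_kernel:
  assumes "positive_even_weight N w" "monic_orthogonal (grid N) w M P h"
    and "2 * n \<le> M" and "x \<in> grid N"
  shows "kernel0 w P h n x y = eta (of_int x) * eta (of_int y) *
      (CD_kernel w P h (2 * n) x y + CD_kernel w P h (2 * n) (- x) y)"
  unfolding CD_kernel_reflect[OF assms]
  by (simp add: kernel0_def CD_kernel_def sum_even_odd_split)

lemma kernel1_eq_CD_kernel:
  assumes "positive_even_weight N w" "monic_orthogonal (grid N) w M P h"
    and "monic_orthogonal (grid N) (\<lambda>x. (of_int x)\<^sup>2 * w x) M' P' h'"
    and nM: "2 * n \<le> M" and nM': "2 * n \<le> M'" and "x \<in> grid N"
  shows "kernel1 w P' h' n x y = CD_kernel w P h (2 * n) x y - CD_kernel w P h (2 * n) (- x) y"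
proof -
  have "orth_fun_hat w P' h' (2 * l) z = orth_fun w P h (Suc (2 * l)) z" if "l < n" for l z
    using that nM nM' by (intro orth_fun_hat_even[OF assms(1-3)]) auto
  then show ?thesis
    unfolding CD_kernel_reflect[OF assms(1,2) nM assms(6)]
    by (simp add: kernel1_def CD_kernel_def sum_even_odd_split)
qed

section \<open>Rounding and passage to the limit\<close>

lemma symmetric_rounding_minus: "symmetric_rounding r \<Longrightarrow> r (- t) = - r t"
  by (simp add: symmetric_rounding_def)

lemma symmetric_rounding_nearest:
  "symmetric_rounding r \<Longrightarrow> \<bar>t - of_int (r t)\<bar> \<le> \<bar>t - of_int k\<bar>"
  by (simp add: symmetric_rounding_def)

lemma symmetric_rounding_bound:
  assumes "symmetric_rounding r"
  shows "\<bar>of_int (r t)\<bar> \<le> 2 * \<bar>t\<bar>"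
  using symmetric_rounding_nearest[OF assms, of t 0] by simp

lemma symmetric_rounding_nonzero:
  assumes "symmetric_rounding r" "\<bar>t\<bar> \<ge> 1"
  shows "r t \<noteq> 0"
proof
  assume "r t = 0"
  then show False
    using symmetric_rounding_nearest[OF assms(1), of t 1]
      symmetric_rounding_nearest[OF assms(1), of t "- 1"] assms(2)
    by simp
qed

lemma eventually_le_of_ratio_limit:
  assumes "(\<lambda>N. real (n N) / real N) \<longlonglongrightarrow> \<gamma>" "\<gamma> < 1"
  shows "\<forall>\<^sub>F N in sequentially. n N \<le> N"
  using order_tendstoD(2)[OF assms] eventually_gt_at_top[of 0]
  by eventually_elim (simp add: divide_simps)

lemma filterlim_of_ratio_limit:
  assumes "(\<lambda>N. real (n N) / real N) \<longlonglongrightarrow> \<gamma>" "0 < \<gamma>"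
  shows "filterlim n at_top sequentially"
proof -
  have "filterlim (\<lambda>N. real (n N) / real N * real N) at_top sequentially"
    by (rule filterlim_tendsto_pos_mult_at_top[OF assms filterlim_real_sequentially])
  moreover have "\<forall>\<^sub>F N in sequentially. real (n N) / real N * real N = real (n N)"
    using eventually_gt_at_top[of 0] by eventually_elim simp
  ultimately have "filterlim (\<lambda>N. real (n N)) at_top sequentially"
    by (simp add: filterlim_cong)
  then show ?thesis by (simp add: filterlim_sequentially_iff_filterlim_real)
qed

lemma eventually_in_grid: "\<forall>\<^sub>F N in sequentially. A \<in> grid N"
  using eventually_ge_at_top[of "nat \<bar>A\<bar>"] by eventually_elim (auto simp: grid_def)

text \<open>
  Rounding at most doubles the modulus, as \<open>0\<close> is a candidate for the nearest integer. So it is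
  enough that \<open>2 * \<bar>A\<bar> * \<bar>D n\<bar> \<le> n\<close> eventually.
\<close>
lemma eventually_rounding_in_grid:
  assumes r: "symmetric_rounding r" and D: "D \<in> o(\<lambda>k. real k)"
    and n: "filterlim n at_top sequentially" and le: "\<forall>\<^sub>F N in sequentially. n N \<le> N"
  shows "\<forall>\<^sub>F N in sequentially. r (D (n N) * A) \<in> grid N"
proof -
  define c where "c = 1 / (2 * \<bar>A\<bar> + 1)"
  have "c > 0" by (simp add: c_def add_nonneg_pos)
  have "\<forall>\<^sub>F k in sequentially. norm (D k) \<le> c * norm (real k)"
    by (rule landau_o.smallD[OF D \<open>c > 0\<close>])
  then have "\<forall>\<^sub>F N in sequentially. norm (D (n N)) \<le> c * norm (real (n N))"
    by (rule eventually_compose_filterlim[OF _ n])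
  then show ?thesis
    using le
  proof eventually_elim
    case (elim N)
    have "\<bar>of_int (r (D (n N) * A))\<bar> \<le> 2 * \<bar>A\<bar> * \<bar>D (n N)\<bar>"
      using symmetric_rounding_bound[OF r, of "D (n N) * A"] by (simp add: abs_mult mult_ac)
    also have "\<dots> \<le> 2 * \<bar>A\<bar> * (c * real (n N))"
      using elim by (intro mult_left_mono) auto
    also have "\<dots> = (2 * \<bar>A\<bar> * c) * real (n N)" by simp
    also have "\<dots> \<le> 1 * real (n N)"
      by (intro mult_right_mono) (auto simp: c_def divide_simps)
    also have "\<dots> \<le> real N" using elim by simp
    finally have "\<bar>r (D (n N) * A)\<bar> \<le> int N" by linarith
    then show ?case by (auto simp: grid_def)
  qed
qed

lemma eventually_eta_rounding:
  assumes r: "symmetric_rounding r" and D: "filterlim d at_top F"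
  shows "\<forall>\<^sub>F N in F. eta (of_int (r (d N * A))) = eta A"
proof (cases "A = 0")
  case True
  have "r 0 = 0" using symmetric_rounding_minus[OF r, of 0] by simp
  then show ?thesis using True by simp
next
  case False
  have "\<forall>\<^sub>F N in F. d N \<ge> 1 / \<bar>A\<bar>"
    using D by (simp add: filterlim_at_top)
  then show ?thesis
  proof eventually_elim
    case (elim N)
    then have "1 \<le> d N * \<bar>A\<bar>" using False by (simp add: divide_simps)
    also have "\<dots> \<le> \<bar>d N * A\<bar>" by (simp add: abs_mult mult_right_mono)
    finally have "r (d N * A) \<noteq> 0" by (rule symmetric_rounding_nonzero[OF r])
    then show ?case using False by (simp add: eta_def)
  qed
qed

theorem proposition3p4:
  fixes w :: "nat \<Rightarrow> int \<Rightarrow> real"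
    and n :: "nat \<Rightarrow> nat"
    and \<gamma> :: real
    and P P' :: "nat \<Rightarrow> nat \<Rightarrow> real poly"
    and h h' :: "nat \<Rightarrow> nat \<Rightarrow> real"
    and r :: "real \<Rightarrow> int"
  assumes weight: "\<And>N. positive_even_weight N (w N)"
    and OP: "\<And>N. monic_orthogonal (grid N) (w N) (2 * N + 1) (P N) (h N)"
    and OP_hat: "\<And>N. monic_orthogonal (grid N) (\<lambda>x. (of_int x)\<^sup>2 * w N x) (2 * N) (P' N) (h' N)"
    and n_pos: "\<And>N. n N > 0"
    and n_lim: "(\<lambda>N. real (n N) / real N) \<longlonglongrightarrow> \<gamma>"
    and gamma: "0 < \<gamma>" "\<gamma> < 1"
    and rounding: "symmetric_rounding r"
  shows
    "(\<forall>Klim :: int \<Rightarrow> int \<Rightarrow> real.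
        (\<forall>A B. (\<lambda>N. CD_kernel (w N) (P N) (h N) (2 * n N) A B) \<longlonglongrightarrow> Klim A B) \<longrightarrow>
        (\<forall>A B.
           (\<lambda>N. kernel0 (w N) (P N) (h N) (n N) A B)
             \<longlonglongrightarrow> eta (of_int A) * eta (of_int B) * (Klim A B + Klim (- A) B) \<and>
           (\<lambda>N. kernel1 (w N) (P' N) (h' N) (n N) A B)
             \<longlonglongrightarrow> Klim A B - Klim (- A) B))
     \<and>
     (\<forall>(D :: nat \<Rightarrow> real) (Klim :: real \<Rightarrow> real \<Rightarrow> real).
        D \<in> o(\<lambda>k. real k) \<longrightarrow>
        filterlim D at_top sequentially \<longrightarrow>
        (\<forall>A B. (\<lambda>N. D (n N) *
                    CD_kernel (w N) (P N) (h N) (2 * n N) (r (D (n N) * A)) (r (D (n N) * B)))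
             \<longlonglongrightarrow> Klim A B) \<longrightarrow>
        (\<forall>A B.
           (\<lambda>N. D (n N) *
                kernel0 (w N) (P N) (h N) (n N) (r (D (n N) * A)) (r (D (n N) * B)))
             \<longlonglongrightarrow> eta A * eta B * (Klim A B + Klim (- A) B) \<and>
           (\<lambda>N. D (n N) *
                kernel1 (w N) (P' N) (h' N) (n N) (r (D (n N) * A)) (r (D (n N) * B)))
             \<longlonglongrightarrow> Klim A B - Klim (- A) B))"
proof (intro conjI allI impI)
  have n_le: "\<forall>\<^sub>F N in sequentially. n N \<le> N"
    by (rule eventually_le_of_ratio_limit[OF n_lim gamma(2)])
  have n_top: "filterlim n at_top sequentially"
    by (rule filterlim_of_ratio_limit[OF n_lim gamma(1)])
  let ?K = "\<lambda>N. CD_kernel (w N) (P N) (h N) (2 * n N)"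
  have K0: "kernel0 (w N) (P N) (h N) (n N) x y
      = eta (of_int x) * eta (of_int y) * (?K N x y + ?K N (- x) y)"
    if "n N \<le> N" "x \<in> grid N" for N x y
    using that by (intro kernel0_eq_CD_kernel[OF weight OP]) auto
  have K1: "kernel1 (w N) (P' N) (h' N) (n N) x y = ?K N x y - ?K N (- x) y"
    if "n N \<le> N" "x \<in> grid N" for N x y
    using that by (intro kernel1_eq_CD_kernel[OF weight OP OP_hat]) auto
  {
    fix Klim :: "int \<Rightarrow> int \<Rightarrow> real" and A B :: int
    assume lim: "\<forall>A B. (\<lambda>N. ?K N A B) \<longlonglongrightarrow> Klim A B"
    have "\<forall>\<^sub>F N in sequentially. eta (of_int A) * eta (of_int B) * (?K N A B + ?K N (- A) B)
        = kernel0 (w N) (P N) (h N) (n N) A B"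
      using n_le eventually_in_grid[of A] by eventually_elim (simp add: K0)
    moreover have "(\<lambda>N. eta (of_int A) * eta (of_int B) * (?K N A B + ?K N (- A) B))
        \<longlonglongrightarrow> eta (of_int A) * eta (of_int B) * (Klim A B + Klim (- A) B)"
      by (intro tendsto_intros lim[rule_format])
    ultimately show "(\<lambda>N. kernel0 (w N) (P N) (h N) (n N) A B)
        \<longlonglongrightarrow> eta (of_int A) * eta (of_int B) * (Klim A B + Klim (- A) B)"
      by (rule Lim_transform_eventually[rotated])
    have "\<forall>\<^sub>F N in sequentially. ?K N A B - ?K N (- A) B
        = kernel1 (w N) (P' N) (h' N) (n N) A B"
      using n_le eventually_in_grid[of A] by eventually_elim (simp add: K1)
    moreover have "(\<lambda>N. ?K N A B - ?K N (- A) B) \<longlonglongrightarrow> Klim A B - Klim (- A) B"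
      by (intro tendsto_intros lim[rule_format])
    ultimately show "(\<lambda>N. kernel1 (w N) (P' N) (h' N) (n N) A B) \<longlonglongrightarrow> Klim A B - Klim (- A) B"
      by (rule Lim_transform_eventually[rotated])
  }
  fix D :: "nat \<Rightarrow> real" and Klim :: "real \<Rightarrow> real \<Rightarrow> real" and A B :: real
  let ?x = "\<lambda>N A. r (D (n N) * A)"
  assume D_small: "D \<in> o(\<lambda>k. real k)" and D_top: "filterlim D at_top sequentially"
    and lim: "\<forall>A B. (\<lambda>N. D (n N) * ?K N (?x N A) (?x N B)) \<longlonglongrightarrow> Klim A B"
  have D_n_top: "filterlim (\<lambda>N. D (n N)) at_top sequentially"
    by (rule filterlim_compose[OF D_top n_top])
  have in_grid: "\<forall>\<^sub>F N in sequentially. ?x N A \<in> grid N"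
    by (rule eventually_rounding_in_grid[OF rounding D_small n_top n_le])
  have reflect: "?x N (- A) = - ?x N A" for N
    using symmetric_rounding_minus[OF rounding, of "D (n N) * A"] by simp
  have lim_reflect: "(\<lambda>N. D (n N) * ?K N (- ?x N A) (?x N B)) \<longlonglongrightarrow> Klim (- A) B"
    using lim[rule_format, of "- A" B] unfolding reflect .
  note eta_ev = eventually_eta_rounding[OF rounding D_n_top]
  have "\<forall>\<^sub>F N in sequentially.
      eta A * eta B * (D (n N) * ?K N (?x N A) (?x N B) + D (n N) * ?K N (- ?x N A) (?x N B))
      = D (n N) * kernel0 (w N) (P N) (h N) (n N) (?x N A) (?x N B)"
    using n_le in_grid eta_ev[of A] eta_ev[of B]
    by eventually_elim (simp add: K0 algebra_simps)
  moreover have "(\<lambda>N. eta A * eta B *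
      (D (n N) * ?K N (?x N A) (?x N B) + D (n N) * ?K N (- ?x N A) (?x N B)))
      \<longlonglongrightarrow> eta A * eta B * (Klim A B + Klim (- A) B)"
    by (intro tendsto_intros lim[rule_format] lim_reflect)
  ultimately show "(\<lambda>N. D (n N) * kernel0 (w N) (P N) (h N) (n N) (?x N A) (?x N B))
      \<longlonglongrightarrow> eta A * eta B * (Klim A B + Klim (- A) B)"
    by (rule Lim_transform_eventually[rotated])
  have "\<forall>\<^sub>F N in sequentially.
      D (n N) * ?K N (?x N A) (?x N B) - D (n N) * ?K N (- ?x N A) (?x N B)
      = D (n N) * kernel1 (w N) (P' N) (h' N) (n N) (?x N A) (?x N B)"
    using n_le in_grid by eventually_elim (simp add: K1 algebra_simps)
  moreover have "(\<lambda>N. D (n N) * ?K N (?x N A) (?x N B) - D (n N) * ?K N (- ?x N A) (?x N B))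
      \<longlonglongrightarrow> Klim A B - Klim (- A) B"
    by (intro tendsto_intros lim[rule_format] lim_reflect)
  ultimately show "(\<lambda>N. D (n N) * kernel1 (w N) (P' N) (h' N) (n N) (?x N A) (?x N B))
      \<longlonglongrightarrow> Klim A B - Klim (- A) B"
    by (rule Lim_transform_eventually[rotated])
qed

end
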